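(* There exists on $c_0$ an equivalent non-symmetric norm $|||\cdot|||$ which is MLUR and whose unit ball $B=\{u\in c_0:|||u|||\le1\}$ has no denting points. Moreover, every slice of $B$ has diameter at least $1/\sqrt2$, i.e. $\sup\{|||u-v|||:u,v\in S\}\ge1/\sqrt2$ for every slice $S$ of $B$.
   Context: $c_0$ is the real Banach space of null sequences with the sup norm $\|\cdot\|_\infty$. A non-symmetric norm is a map $|||\cdot|||:c_0\to[0,\infty)$ that is subadditive, positively homogeneous ($|||tx|||=t|||x|||$ for $t\ge0$), vanishes only at $0$, and does not satisfy $|||-x|||=|||x|||$ for all $x$. It is equivalent if there are $a,b>0$ with $a\|x\|_\infty\le|||x|||\le b\|x\|_\infty$ for all $x$. $|||\cdot|||$ is MLUR (midpoint locally uniformly rotund) if every $x$ with $|||x|||=1$ is a strongly extreme point of $B$, equivalently, for every such $x$ and every sequence $(x_n)$ in $c_0$, $\lim_n|||x+x_n|||=\lim_n|||x-x_n|||=1$ implies $\lim_n\|x_n\|_\infty=0$. A slice of $B$ is a set $S(B,x^*,\delta)=\{y\in B:x^*(y)>\sup_{z\in B}x^*(z)-\delta\}$ with $\delta>0$, $0\ne x^*\in c_0^*$. A point $x\in B$ is a denting point of $B$ if for every $\varepsilon>0$ and $\delta>0$ there is a slice $S(B,x^*,\delta)$ which contains $x$ and has diameter less than $\varepsilon$. *)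

theory Defs
  imports "HOL-Analysis.Analysis"
begin

section \<open>The space of real null sequences with the sup norm\<close>

typedef c0 = "{x :: nat \<Rightarrow> real. x \<longlonglongrightarrow> 0}"
  morphisms c0_nth Abs_c0
  by (rule exI[of _ "\<lambda>_. 0"]) simp

setup_lifting type_definition_c0

instantiation c0 :: real_vector
begin

lift_definition zero_c0 :: c0 is "\<lambda>_. 0"
  by simp

lift_definition plus_c0 :: "c0 \<Rightarrow> c0 \<Rightarrow> c0" is "\<lambda>x y n. x n + y n"
  using tendsto_add by fastforce

lift_definition uminus_c0 :: "c0 \<Rightarrow> c0" is "\<lambda>x n. - x n"
  using tendsto_minus by fastforce

lift_definition minus_c0 :: "c0 \<Rightarrow> c0 \<Rightarrow> c0" is "\<lambda>x y n. x n - y n"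
  using tendsto_diff by fastforce

lift_definition scaleR_c0 :: "real \<Rightarrow> c0 \<Rightarrow> c0" is "\<lambda>t x n. t * x n"
  using tendsto_mult_right_zero by blast

instance
  by standard (transfer; simp add: fun_eq_iff algebra_simps)+

end

lemma c0_bdd_above: "bdd_above (range (\<lambda>n. \<bar>c0_nth x n\<bar>))"
proof -
  have "c0_nth x \<longlonglongrightarrow> 0"
    using c0_nth by blast
  then have "Bseq (c0_nth x)"
    by (intro convergent_imp_Bseq convergentI)
  then show ?thesis
    by (auto simp: Bseq_def bdd_above_def)
qed

instantiation c0 :: real_normed_vector
begin

definition norm_c0 :: "c0 \<Rightarrow> real"
  where "norm_c0 x = (SUP n. \<bar>c0_nth x n\<bar>)"

definition dist_c0 :: "c0 \<Rightarrow> c0 \<Rightarrow> real"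
  where "dist_c0 x y = norm (x - y)"

definition sgn_c0 :: "c0 \<Rightarrow> c0"
  where "sgn_c0 x = x /\<^sub>R norm x"

definition uniformity_c0 :: "(c0 \<times> c0) filter"
  where "uniformity_c0 = (INF e\<in>{0<..}. principal {(x, y). dist x y < e})"

definition open_c0 :: "c0 set \<Rightarrow> bool"
  where "open_c0 U \<longleftrightarrow> (\<forall>x\<in>U. \<forall>\<^sub>F (x', y) in uniformity. x' = x \<longrightarrow> y \<in> U)"

instance
proof
  fix x y :: c0 and a :: real
  have le: "\<bar>c0_nth z n\<bar> \<le> norm z" for z n
    unfolding norm_c0_def by (rule cSUP_upper[OF UNIV_I c0_bdd_above])
  show "dist x y = norm (x - y)"
    by (rule dist_c0_def)
  show "sgn x = x /\<^sub>R norm x"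
    by (rule sgn_c0_def)
  show "uniformity = (INF e\<in>{0<..}. principal {(x :: c0, y). dist x y < e})"
    by (rule uniformity_c0_def)
  show "open U \<longleftrightarrow> (\<forall>x\<in>U. \<forall>\<^sub>F (x', y) in uniformity. x' = x \<longrightarrow> y \<in> U)" for U :: "c0 set"
    by (rule open_c0_def)
  show "norm x = 0 \<longleftrightarrow> x = 0"
  proof
    assume "norm x = 0"
    then have "c0_nth x n = 0" for n
      using le[of x n] by simp
    then show "x = 0"
      by transfer auto
  next
    assume "x = 0"
    then show "norm x = 0"
      by (simp add: norm_c0_def zero_c0.rep_eq)
  qed
  show "norm (x + y) \<le> norm x + norm y"
    unfolding norm_c0_def[of "x + y"]
  proof (rule cSUP_least)
    fix n
    show "\<bar>c0_nth (x + y) n\<bar> \<le> norm x + norm y"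
      using le[of x n] le[of y n] by (simp add: plus_c0.rep_eq)
  qed simp
  have scale: "norm (t *\<^sub>R z) \<le> \<bar>t\<bar> * norm z" for t and z :: c0
    unfolding norm_c0_def[of "t *\<^sub>R z"]
  proof (rule cSUP_least)
    fix n
    show "\<bar>c0_nth (t *\<^sub>R z) n\<bar> \<le> \<bar>t\<bar> * norm z"
      using le[of z n] by (simp add: scaleR_c0.rep_eq abs_mult mult_left_mono)
  qed simp
  show "norm (a *\<^sub>R x) = \<bar>a\<bar> * norm x"
  proof (cases "a = 0")
    case True
    then show ?thesis
      using scale[of a x] le[of "a *\<^sub>R x" 0] by simp
  next
    case False
    then have "norm x \<le> \<bar>inverse a\<bar> * norm (a *\<^sub>R x)"
      using scale[of "inverse a" "a *\<^sub>R x"] by simp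
    then show ?thesis
      using False scale[of a x] by (simp add: field_simps)
  qed
qed

end


section \<open>Non-symmetric norms\<close>

definition nonsymmetric_norm :: "('a::real_normed_vector \<Rightarrow> real) \<Rightarrow> bool"
  where "nonsymmetric_norm N \<longleftrightarrow>
    (\<forall>x. 0 \<le> N x) \<and>
    (\<forall>x y. N (x + y) \<le> N x + N y) \<and>
    (\<forall>t x. 0 \<le> t \<longrightarrow> N (t *\<^sub>R x) = t * N x) \<and>
    (\<forall>x. N x = 0 \<longrightarrow> x = 0) \<and>
    \<not> (\<forall>x. N (- x) = N x)"

definition equivalent_norm :: "('a::real_normed_vector \<Rightarrow> real) \<Rightarrow> bool"
  where "equivalent_norm N \<longleftrightarrow>
    (\<exists>a>0. \<exists>b>0. \<forall>x. a * norm x \<le> N x \<and> N x \<le> b * norm x)"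

text \<open>The limits of the two sequences of values are taken with respect to \<open>N\<close>; the
  perturbations tend to zero in the original norm.\<close>

definition MLUR :: "('a::real_normed_vector \<Rightarrow> real) \<Rightarrow> bool"
  where "MLUR N \<longleftrightarrow>
    (\<forall>x. N x = 1 \<longrightarrow>
      (\<forall>X :: nat \<Rightarrow> 'a.
        (\<lambda>n. N (x + X n)) \<longlonglongrightarrow> 1 \<and> (\<lambda>n. N (x - X n)) \<longlonglongrightarrow> 1 \<longrightarrow>
        (\<lambda>n. norm (X n)) \<longlonglongrightarrow> 0))"

definition unit_ball :: "('a::real_normed_vector \<Rightarrow> real) \<Rightarrow> 'a set"
  where "unit_ball N = {u. N u \<le> 1}"

definition slice :: "('a::real_normed_vector) set \<Rightarrow> ('a \<Rightarrow>\<^sub>L real) \<Rightarrow> real \<Rightarrow> 'a set"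
  where "slice B f \<delta> = {y \<in> B. blinfun_apply f y > (SUP z\<in>B. blinfun_apply f z) - \<delta>}"

definition is_slice :: "('a::real_normed_vector) set \<Rightarrow> 'a set \<Rightarrow> bool"
  where "is_slice B S \<longleftrightarrow> (\<exists>f \<delta>. f \<noteq> 0 \<and> \<delta> > 0 \<and> S = slice B f \<delta>)"

text \<open>The supremum runs over ordered pairs, because \<open>N (u - v)\<close> and \<open>N (v - u)\<close> may differ.
  It is a supremum of reals, hence meaningful for nonempty \<open>N\<close>-bounded sets; slices of the
  unit ball of an equivalent non-symmetric norm are such sets.\<close>

definition norm_diameter :: "('a::real_normed_vector \<Rightarrow> real) \<Rightarrow> 'a set \<Rightarrow> real"
  where "norm_diameter N S = (SUP (u, v)\<in>S \<times> S. N (u - v))"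

definition denting_point :: "('a::real_normed_vector \<Rightarrow> real) \<Rightarrow> 'a set \<Rightarrow> 'a \<Rightarrow> bool"
  where "denting_point N B x \<longleftrightarrow>
    x \<in> B \<and>
    (\<forall>\<epsilon>>0. \<forall>\<delta>>0. \<exists>f. f \<noteq> 0 \<and> x \<in> slice B f \<delta> \<and> norm_diameter N (slice B f \<delta>) < \<epsilon>)"

end

theory Submission
  imports Defs
begin

text \<open>
  For a null sequence \<open>x\<close> let \<open>tail_dip k x\<close> measure how far the coordinates of \<open>x\<close> from \<open>k\<close>
  onwards dip below zero.  The norm is
  \<open>N x = sqrt (\<parallel>x\<parallel>\<^sup>2 + (\<Sum>k. (1/2)^(k+2) * (x\<^sub>k\<^sup>2 + (tail_dip k x)\<^sup>2)))\<close>.  The radicand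
  is convex and homogeneous of degree two, so \<open>N\<close> is sublinear.  The weights are chosen so that
  the radicand lies between \<open>\<parallel>x\<parallel>\<^sup>2\<close> and \<open>2 * \<parallel>x\<parallel>\<^sup>2\<close>; this factor two is the source of \<open>sqrt 2\<close>.

  The asymmetry reconciles two properties that pull in opposite directions.  Far out, adding a
  bump to \<open>x\<close> upwards is nearly free, as it only lowers the dips: \<open>N (x + \<parallel>x\<parallel> e\<^sub>n)\<close> hardly
  exceeds \<open>N x\<close> for large \<open>n\<close>.  As \<open>f e\<^sub>n\<close> tends to zero for every functional \<open>f\<close>, each slice
  contains pairs \<open>x\<close>, \<open>x + \<parallel>x\<parallel> e\<^sub>n\<close> with \<open>N x\<close> close to \<open>1\<close>, and \<open>\<parallel>x\<parallel> \<ge> N x / sqrt 2\<close> gives the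
  bound on the diameter, which also excludes denting points.

  A bump downwards, in contrast, is seen by \<open>tail_dip k\<close> once the coordinates of \<open>x\<close> from \<open>k\<close>
  onwards are small.  If \<open>N (x + X\<^sub>n)\<close> and \<open>N (x - X\<^sub>n)\<close> tend to \<open>N x = 1\<close>, then the midpoint
  defect of the radicand tends to zero, hence so does that of each convex summand.  The squares of
  coordinates force \<open>X\<^sub>n\<close> to zero in each coordinate, and the dips exclude downward bumps far out
  for both \<open>X\<^sub>n\<close> and \<open>- X\<^sub>n\<close>.  Hence \<open>X\<^sub>n\<close> tends to zero uniformly, which is midpoint local
  uniform rotundity.
\<close>

section \<open>Coordinates and unit vectors\<close>

lemma abs_c0_nth_le_norm: "\<bar>c0_nth x n\<bar> \<le> norm x"
  unfolding norm_c0_def by (rule cSUP_upper[OF UNIV_I c0_bdd_above])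

lemma norm_c0_le: "norm x \<le> b" if "\<And>n. \<bar>c0_nth x n\<bar> \<le> b"
  unfolding norm_c0_def by (rule cSUP_least) (use that in auto)

lemma c0_nth_tendsto_zero: "c0_nth x \<longlonglongrightarrow> 0"
  using c0_nth by blast

lift_definition unit_c0 :: "nat \<Rightarrow> c0" is "\<lambda>n k. if k = n then 1 else 0"
proof -
  fix n :: nat
  show "(\<lambda>k. if k = n then 1 else 0 :: real) \<longlonglongrightarrow> 0"
    by (rule tendsto_eventually) (use eventually_gt_at_top[of n] in eventually_elim, simp)
qed

lemma c0_nth_sum_unit:
  "c0_nth (\<Sum>i<m. a i *\<^sub>R unit_c0 i) k = (if k < m then a k else 0)"
  by (induction m)
    (auto simp: less_Suc_eq zero_c0.rep_eq plus_c0.rep_eq scaleR_c0.rep_eq unit_c0.rep_eq)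

text \<open>The values on the unit vectors are even absolutely summable: a partial sum of their
  absolute values is the value of the functional at a vector of signs, which has norm at most
  one.\<close>

lemma blinfun_unit_c0_tendsto_zero:
  fixes f :: "c0 \<Rightarrow>\<^sub>L real"
  shows "(\<lambda>n. blinfun_apply f (unit_c0 n)) \<longlonglongrightarrow> 0"
proof -
  have "(\<Sum>i<m. \<bar>blinfun_apply f (unit_c0 i)\<bar>) \<le> norm f" for m
  proof -
    let ?v = "\<Sum>i<m. sgn (blinfun_apply f (unit_c0 i)) *\<^sub>R unit_c0 i"
    have "norm ?v \<le> 1"
      by (rule norm_c0_le) (auto simp: c0_nth_sum_unit abs_sgn_eq)
    then have "norm (blinfun_apply f ?v) \<le> norm f"
      using norm_blinfun[of f ?v] mult_left_le[of "norm ?v" "norm f"] by simp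
    moreover have "blinfun_apply f ?v = (\<Sum>i<m. \<bar>blinfun_apply f (unit_c0 i)\<bar>)"
      by (simp add: blinfun.sum_right blinfun.scaleR_right abs_sgn mult.commute)
    ultimately show ?thesis
      by simp
  qed
  then have "summable (\<lambda>i. \<bar>blinfun_apply f (unit_c0 i)\<bar>)"
    by (intro bounded_imp_summable[where B = "norm f"])
      (simp, simp only: flip: lessThan_Suc_atMost)
  then show ?thesis
    using summable_LIMSEQ_zero tendsto_rabs_zero_iff by blast
qed


section \<open>Downward dips of the tail\<close>

definition tail_dip :: "nat \<Rightarrow> c0 \<Rightarrow> real"
  where "tail_dip k x = (SUP j\<in>{k..}. max 0 (- c0_nth x j))"

lemma tail_dip_le: "tail_dip k x \<le> b" if "0 \<le> b" "\<And>j. k \<le> j \<Longrightarrow> - c0_nth x j \<le> b"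
  unfolding tail_dip_def by (rule cSUP_least) (use that in auto)

lemma tail_dip_upper: "max 0 (- c0_nth x j) \<le> tail_dip k x" if "k \<le> j"
  unfolding tail_dip_def
proof (rule cSUP_upper)
  show "bdd_above ((\<lambda>j. max 0 (- c0_nth x j)) ` {k..})"
  proof (rule bdd_aboveI2)
    show "max 0 (- c0_nth x i) \<le> norm x" for i
      using abs_c0_nth_le_norm[of x i] by auto
  qed
qed (use that in simp)

lemma tail_dip_nonneg: "0 \<le> tail_dip k x"
  using tail_dip_upper[of k k x] by simp

lemma tail_dip_ge: "k \<le> j \<Longrightarrow> - c0_nth x j \<le> tail_dip k x"
  using tail_dip_upper[of k j x] by simp

lemma tail_dip_le_norm: "tail_dip k x \<le> norm x"
proof (rule tail_dip_le)
  show "- c0_nth x j \<le> norm x" for j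
    using abs_c0_nth_le_norm[of x j] by simp
qed simp

lemma tail_dip_add: "tail_dip k (x + y) \<le> tail_dip k x + tail_dip k y"
proof (rule tail_dip_le)
  show "- c0_nth (x + y) j \<le> tail_dip k x + tail_dip k y" if "k \<le> j" for j
    using tail_dip_ge[OF that, of x] tail_dip_ge[OF that, of y] by (simp add: plus_c0.rep_eq)
qed (simp add: tail_dip_nonneg)

lemma tail_dip_scaleR_le: "tail_dip k (t *\<^sub>R x) \<le> t * tail_dip k x" if "0 \<le> t"
proof (rule tail_dip_le)
  show "- c0_nth (t *\<^sub>R x) j \<le> t * tail_dip k x" if "k \<le> j" for j
    using mult_left_mono[OF tail_dip_ge[OF that, of x] \<open>0 \<le> t\<close>] by (simp add: scaleR_c0.rep_eq)
qed (simp add: tail_dip_nonneg that)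

lemma tail_dip_scaleR: "tail_dip k (t *\<^sub>R x) = t * tail_dip k x" if "0 \<le> t"
proof (cases "t = 0")
  case True
  then show ?thesis
    using tail_dip_scaleR_le[of 0 k x] tail_dip_nonneg[of k "0 *\<^sub>R x"] by simp
next
  case False
  then have "tail_dip k x \<le> inverse t * tail_dip k (t *\<^sub>R x)"
    using tail_dip_scaleR_le[of "inverse t" k "t *\<^sub>R x"] that by simp
  then show ?thesis
    using tail_dip_scaleR_le[OF that, of k x] False that by (simp add: field_simps)
qed

lemma tail_dip_antimono:
  "tail_dip k y \<le> tail_dip k x" if "\<And>j. c0_nth x j \<le> c0_nth y j"
proof (rule tail_dip_le)
  show "- c0_nth y j \<le> tail_dip k x" if "k \<le> j" for j
    using tail_dip_ge[OF that, of x] \<open>\<And>j. c0_nth x j \<le> c0_nth y j\<close>[of j] by simp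
qed (rule tail_dip_nonneg)


section \<open>The energy, a convex function homogeneous of degree two\<close>

definition energy_term :: "nat \<Rightarrow> c0 \<Rightarrow> real"
  where "energy_term k x = (1 / 2) ^ (k + 2) * ((c0_nth x k)\<^sup>2 + (tail_dip k x)\<^sup>2)"

definition energy :: "c0 \<Rightarrow> real"
  where "energy x = (norm x)\<^sup>2 + (\<Sum>k. energy_term k x)"

lemma energy_term_nonneg: "0 \<le> energy_term k x"
  by (simp add: energy_term_def)

lemma energy_term_le: "energy_term k x \<le> (norm x)\<^sup>2 * (1 / 2) ^ Suc k"
proof -
  have "(c0_nth x k)\<^sup>2 \<le> (norm x)\<^sup>2"
    using power_mono[OF abs_c0_nth_le_norm[of x k] abs_ge_zero, of 2] by simp
  moreover have "(tail_dip k x)\<^sup>2 \<le> (norm x)\<^sup>2"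
    using power_mono[OF tail_dip_le_norm tail_dip_nonneg] by blast
  ultimately have "energy_term k x \<le> (1 / 2) ^ (k + 2) * ((norm x)\<^sup>2 + (norm x)\<^sup>2)"
    unfolding energy_term_def by (intro mult_left_mono add_mono) auto
  then show ?thesis
    by (simp add: field_simps)
qed

lemma summable_energy_term: "summable (\<lambda>k. energy_term k x)"
proof (rule summable_comparison_test')
  show "summable (\<lambda>k. (norm x)\<^sup>2 * (1 / 2 :: real) ^ Suc k)"
    by (intro summable_mult sums_summable[OF power_half_series])
  show "norm (energy_term k x) \<le> (norm x)\<^sup>2 * (1 / 2) ^ Suc k" for k
    using energy_term_le energy_term_nonneg by simp
qed

lemma norm_sq_le_energy: "(norm x)\<^sup>2 \<le> energy x"
  unfolding energy_def
  using suminf_nonneg[OF summable_energy_term energy_term_nonneg] by simp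

lemma energy_le_norm_sq: "energy x \<le> 2 * (norm x)\<^sup>2"
proof -
  have s: "(\<lambda>k. (norm x)\<^sup>2 * (1 / 2) ^ Suc k) sums ((norm x)\<^sup>2 * 1)"
    by (intro sums_mult power_half_series)
  have "(\<Sum>k. energy_term k x) \<le> (\<Sum>k. (norm x)\<^sup>2 * (1 / 2) ^ Suc k)"
    using suminf_le[OF energy_term_le summable_energy_term sums_summable[OF s]] .
  then show ?thesis
    unfolding energy_def using sums_unique[OF s] by simp
qed

lemma energy_nonneg: "0 \<le> energy x"
  using norm_sq_le_energy[of x] zero_le_power2[of "norm x"] by linarith

lemma energy_scaleR: "energy (t *\<^sub>R x) = t\<^sup>2 * energy x" if "0 \<le> t"
proof -
  have "energy_term k (t *\<^sub>R x) = t\<^sup>2 * energy_term k x" for k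
    using that by (simp add: energy_term_def tail_dip_scaleR scaleR_c0.rep_eq algebra_simps)
  then show ?thesis
    using suminf_mult[OF summable_energy_term, of "t\<^sup>2" x]
    by (simp add: energy_def power_mult_distrib distrib_left)
qed

lemma square_convex_bound:
  fixes a b c u v :: real
  assumes "0 \<le> c" "c \<le> u * a + v * b" "0 \<le> u" "0 \<le> v" "u + v = 1"
  shows "c\<^sup>2 \<le> u * a\<^sup>2 + v * b\<^sup>2"
proof -
  have "c\<^sup>2 \<le> (u * a + v * b)\<^sup>2"
    using assms by (intro power_mono) auto
  also have "\<dots> = u * a\<^sup>2 + v * b\<^sup>2 - u * v * (a - b)\<^sup>2"
  proof -
    have v: "v = 1 - u"
      using assms by simp
    show ?thesis
      unfolding v by (simp add: power2_eq_square algebra_simps)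
  qed
  also have "\<dots> \<le> u * a\<^sup>2 + v * b\<^sup>2"
    using assms by simp
  finally show ?thesis .
qed

context
  fixes u v :: real
  assumes uv: "0 \<le> u" "0 \<le> v" "u + v = 1"
begin

lemma norm_sq_convex:
  "(norm (u *\<^sub>R x + v *\<^sub>R y))\<^sup>2 \<le> u * (norm x)\<^sup>2 + v * (norm y)\<^sup>2" for x y :: c0
  by (rule square_convex_bound) (use uv norm_triangle_ineq[of "u *\<^sub>R x" "v *\<^sub>R y"] in auto)

lemma tail_dip_sq_convex:
  "(tail_dip k (u *\<^sub>R x + v *\<^sub>R y))\<^sup>2 \<le> u * (tail_dip k x)\<^sup>2 + v * (tail_dip k y)\<^sup>2"
  by (rule square_convex_bound)
    (use uv tail_dip_add[of k "u *\<^sub>R x" "v *\<^sub>R y"] in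
      \<open>auto simp: tail_dip_nonneg tail_dip_scaleR\<close>)

lemma c0_nth_sq_convex:
  "(c0_nth (u *\<^sub>R x + v *\<^sub>R y) k)\<^sup>2 \<le> u * (c0_nth x k)\<^sup>2 + v * (c0_nth y k)\<^sup>2"
proof -
  have "\<bar>c0_nth (u *\<^sub>R x + v *\<^sub>R y) k\<bar>\<^sup>2 \<le> u * \<bar>c0_nth x k\<bar>\<^sup>2 + v * \<bar>c0_nth y k\<bar>\<^sup>2"
    by (rule square_convex_bound)
      (use uv abs_triangle_ineq[of "u * c0_nth x k" "v * c0_nth y k"] in
        \<open>auto simp: plus_c0.rep_eq scaleR_c0.rep_eq abs_mult\<close>)
  then show ?thesis
    by simp
qed

lemma energy_term_convex:
  "energy_term k (u *\<^sub>R x + v *\<^sub>R y) \<le> u * energy_term k x + v * energy_term k y"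
proof -
  have "energy_term k (u *\<^sub>R x + v *\<^sub>R y) \<le> (1 / 2) ^ (k + 2) *
      ((u * (c0_nth x k)\<^sup>2 + v * (c0_nth y k)\<^sup>2) + (u * (tail_dip k x)\<^sup>2 + v * (tail_dip k y)\<^sup>2))"
    unfolding energy_term_def
    by (intro mult_left_mono add_mono c0_nth_sq_convex tail_dip_sq_convex) simp
  also have "\<dots> = u * energy_term k x + v * energy_term k y"
    unfolding energy_term_def by algebra
  finally show ?thesis .
qed

text \<open>The stronger form of convexity that keeps the defect of a single summand is what midpoint
  rotundity needs: a small defect of the energy forces every summand to have a small one.\<close>

lemma energy_term_defect_le:
  "u * energy_term k x + v * energy_term k y - energy_term k (u *\<^sub>R x + v *\<^sub>R y)
    \<le> u * energy x + v * energy y - energy (u *\<^sub>R x + v *\<^sub>R y)"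
proof -
  define d where
    "d i = u * energy_term i x + v * energy_term i y - energy_term i (u *\<^sub>R x + v *\<^sub>R y)" for i
  have d: "d sums (u * (\<Sum>i. energy_term i x) + v * (\<Sum>i. energy_term i y)
      - (\<Sum>i. energy_term i (u *\<^sub>R x + v *\<^sub>R y)))"
    unfolding d_def
    by (intro sums_diff sums_add sums_mult summable_sums summable_energy_term)
  have "sum d {k} \<le> suminf d"
    using energy_term_convex by (intro sum_le_suminf sums_summable[OF d]) (auto simp: d_def)
  then have "d k \<le> suminf d"
    by simp
  also have "suminf d \<le> u * energy x + v * energy y - energy (u *\<^sub>R x + v *\<^sub>R y)"
    using norm_sq_convex[of x y] unfolding sums_unique[OF d, symmetric] energy_def
    by (simp add: distrib_left)
  finally show ?thesis
    unfolding d_def .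
qed

lemma energy_convex: "energy (u *\<^sub>R x + v *\<^sub>R y) \<le> u * energy x + v * energy y"
  using energy_term_defect_le[of 0 x y] energy_term_convex[of 0 x y] by linarith

end


section \<open>The norm\<close>

definition dip_norm :: "c0 \<Rightarrow> real"
  where "dip_norm x = sqrt (energy x)"

lemma dip_norm_sq: "(dip_norm x)\<^sup>2 = energy x"
  by (simp add: dip_norm_def energy_nonneg)

lemma dip_norm_nonneg: "0 \<le> dip_norm x"
  by (simp add: dip_norm_def energy_nonneg)

lemma norm_le_dip_norm: "norm x \<le> dip_norm x"
  unfolding dip_norm_def by (rule real_le_rsqrt) (rule norm_sq_le_energy)

lemma dip_norm_le_norm: "dip_norm x \<le> sqrt 2 * norm x"
  unfolding dip_norm_def using real_sqrt_le_mono[OF energy_le_norm_sq[of x]]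
  by (simp add: real_sqrt_mult)

lemma dip_norm_eq_0_iff: "dip_norm x = 0 \<longleftrightarrow> x = 0"
  using norm_le_dip_norm[of x] dip_norm_le_norm[of x] dip_norm_nonneg[of x] by auto

lemma dip_norm_scaleR: "dip_norm (t *\<^sub>R x) = t * dip_norm x" if "0 \<le> t"
  using that by (simp add: dip_norm_def energy_scaleR real_sqrt_mult)

text \<open>The sum \<open>x + y\<close> is \<open>a + b\<close> times a convex combination of the normalised vectors \<open>x / a\<close> and
  \<open>y / b\<close>, both of energy one.\<close>

lemma dip_norm_triangle: "dip_norm (x + y) \<le> dip_norm x + dip_norm y"
proof (cases "x = 0 \<or> y = 0")
  case True
  then show ?thesis
    by (auto simp: dip_norm_nonneg)
next
  case False
  define a b where "a = dip_norm x" and "b = dip_norm y"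
  have ab: "0 < a" "0 < b"
    using False dip_norm_nonneg[of x] dip_norm_nonneg[of y] dip_norm_eq_0_iff
    by (auto simp: a_def b_def less_le)
  have energy_x: "energy x = a\<^sup>2" and energy_y: "energy y = b\<^sup>2"
    by (simp_all add: a_def b_def dip_norm_sq)
  let ?z = "(a / (a + b)) *\<^sub>R (inverse a *\<^sub>R x) + (b / (a + b)) *\<^sub>R (inverse b *\<^sub>R y)"
  have "x + y = (a + b) *\<^sub>R ?z"
    using ab by (simp add: scaleR_add_right)
  then have "energy (x + y) = (a + b)\<^sup>2 * energy ?z"
    using energy_scaleR[of "a + b" ?z] ab by simp
  also have "energy ?z \<le> a / (a + b) * energy (inverse a *\<^sub>R x)
      + b / (a + b) * energy (inverse b *\<^sub>R y)"
    using ab by (intro energy_convex) (auto simp flip: add_divide_distrib)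
  also have "energy (inverse a *\<^sub>R x) = 1"
    using ab energy_x by (simp add: energy_scaleR flip: power_mult_distrib)
  also have "energy (inverse b *\<^sub>R y) = 1"
    using ab energy_y by (simp add: energy_scaleR flip: power_mult_distrib)
  finally have "energy (x + y) \<le> (a + b)\<^sup>2"
    using ab by (simp flip: add_divide_distrib)
  then show ?thesis
    using ab unfolding a_def b_def dip_norm_def[of "x + y"]
    by (intro real_le_lsqrt) auto
qed

lemma dip_norm_not_symmetric: "dip_norm (- unit_c0 0) \<noteq> dip_norm (unit_c0 0)"
proof -
  have up: "tail_dip k (unit_c0 0) = 0" for k
    using tail_dip_nonneg[of k "unit_c0 0"] tail_dip_le[of 0 k "unit_c0 0"]
    by (simp add: unit_c0.rep_eq antisym)
  have down: "1 \<le> tail_dip 0 (- unit_c0 0)"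
    using tail_dip_ge[of 0 0 "- unit_c0 0"] by (simp add: uminus_c0.rep_eq unit_c0.rep_eq)
  have "0 < (\<Sum>k. energy_term k (- unit_c0 0) - energy_term k (unit_c0 0))"
  proof (rule suminf_pos2)
    show "summable (\<lambda>k. energy_term k (- unit_c0 0) - energy_term k (unit_c0 0))"
      by (intro summable_diff summable_energy_term)
    show "0 \<le> energy_term k (- unit_c0 0) - energy_term k (unit_c0 0)" for k
      by (simp add: energy_term_def up uminus_c0.rep_eq)
    show "0 < energy_term 0 (- unit_c0 0) - energy_term 0 (unit_c0 0)"
      using down by (simp add: energy_term_def up uminus_c0.rep_eq)
  qed
  then have "(\<Sum>k. energy_term k (unit_c0 0)) < (\<Sum>k. energy_term k (- unit_c0 0))"
    by (simp flip: suminf_diff add: summable_energy_term)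
  then show ?thesis
    by (simp add: dip_norm_def energy_def)
qed

lemma nonsymmetric_norm_dip_norm: "nonsymmetric_norm dip_norm"
  unfolding nonsymmetric_norm_def
  using dip_norm_nonneg dip_norm_triangle dip_norm_scaleR dip_norm_eq_0_iff
    dip_norm_not_symmetric by blast

lemma equivalent_norm_dip_norm: "equivalent_norm dip_norm"
  unfolding equivalent_norm_def
  by (rule exI[of _ 1], simp, rule exI[of _ "sqrt 2"])
    (simp add: norm_le_dip_norm dip_norm_le_norm)


section \<open>Midpoint local uniform rotundity\<close>

text \<open>The midpoint defect of a single summand of the energy controls the perturbation in that
  coordinate, and bounds how far both perturbed vectors dip.\<close>

lemma midpoint_defect_bounds:
  defines "D x y \<equiv> (energy (x + y) + energy (x - y)) / 2 - energy x"
  shows "(c0_nth y k)\<^sup>2 \<le> 2 ^ (k + 2) * D x y"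
    and "(tail_dip k (x + y))\<^sup>2 + (tail_dip k (x - y))\<^sup>2
      \<le> 2 * (tail_dip k x)\<^sup>2 + 2 ^ (k + 3) * D x y"
proof -
  have mid: "(1 / 2) *\<^sub>R (x + y) + (1 / 2) *\<^sub>R (x - y) = x"
    by (simp add: scaleR_add_right scaleR_diff_right flip: scaleR_add_left)
  define c where "c = ((c0_nth (x + y) k)\<^sup>2 + (c0_nth (x - y) k)\<^sup>2) / 2 - (c0_nth x k)\<^sup>2"
  define t where "t = ((tail_dip k (x + y))\<^sup>2 + (tail_dip k (x - y))\<^sup>2) / 2 - (tail_dip k x)\<^sup>2"
  have c: "c = (c0_nth y k)\<^sup>2"
    by (simp add: c_def plus_c0.rep_eq minus_c0.rep_eq power2_eq_square algebra_simps)
  have t: "0 \<le> t"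
    using tail_dip_sq_convex[of "1/2" "1/2" k "x + y" "x - y"] unfolding mid t_def by simp
  have "(1 / 2) ^ (k + 2) * (c + t)
      = 1/2 * energy_term k (x + y) + 1/2 * energy_term k (x - y) - energy_term k x"
    unfolding energy_term_def c_def t_def by (simp add: field_simps)
  also have "\<dots> \<le> D x y"
    using energy_term_defect_le[of "1/2" "1/2" k "x + y" "x - y"]
    unfolding mid D_def by (simp add: add_divide_distrib)
  finally have "(1 / 2) ^ (k + 2) * (c + t) \<le> D x y" .
  then have ct: "c + t \<le> 2 ^ (k + 2) * D x y"
    by (simp add: field_simps)
  then show "(c0_nth y k)\<^sup>2 \<le> 2 ^ (k + 2) * D x y"
    using c t by simp
  have "t \<le> 2 ^ (k + 2) * D x y"
    using ct c zero_le_power2[of "c0_nth y k"] by linarith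
  then show "(tail_dip k (x + y))\<^sup>2 + (tail_dip k (x - y))\<^sup>2 
      \<le> 2 * (tail_dip k x)\<^sup>2 + 2 ^ (k + 3) * D x y"
    unfolding t_def by (simp add: field_simps power_add)
qed

lemma MLUR_dip_norm: "MLUR dip_norm"
  unfolding MLUR_def
proof (intro allI impI, elim conjE)
  fix x :: c0 and X :: "nat \<Rightarrow> c0"
  assume x: "dip_norm x = 1"
    and X: "(\<lambda>n. dip_norm (x + X n)) \<longlonglongrightarrow> 1" "(\<lambda>n. dip_norm (x - X n)) \<longlonglongrightarrow> 1"
  define D where "D n = (energy (x + X n) + energy (x - X n)) / 2 - energy x" for n
  have "(\<lambda>n. ((dip_norm (x + X n))\<^sup>2 + (dip_norm (x - X n))\<^sup>2) / 2 - (dip_norm x)\<^sup>2)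
      \<longlonglongrightarrow> (1\<^sup>2 + 1\<^sup>2) / 2 - 1\<^sup>2"
    unfolding x by (intro tendsto_intros X) simp
  then have D: "D \<longlonglongrightarrow> 0"
    unfolding dip_norm_sq D_def[abs_def] by simp
  have D_small: "\<forall>\<^sub>F n in sequentially. c * D n < e" if "0 < e" for c e :: real
    using order_tendstoD(2)[OF tendsto_mult_right_zero[OF D]] that by blast
  show "(\<lambda>n. norm (X n)) \<longlonglongrightarrow> 0"
  proof (rule tendstoI)
    fix e' :: real
    assume "0 < e'"
    define e where "e = e' / 4"
    \<comment> \<open>Beyond \<open>K\<close>, a dip of at most \<open>2 * e\<close> at a coordinate of \<open>x\<close> below \<open>e\<close> leaves room for a
      perturbation of at most \<open>3 * e\<close>.\<close>
    have e: "0 < e"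
      using \<open>0 < e'\<close> by (simp add: e_def)
    obtain K where K: "\<And>j. K \<le> j \<Longrightarrow> \<bar>c0_nth x j\<bar> < e"
      using LIMSEQ_D[OF c0_nth_tendsto_zero e] by auto
    have "tail_dip K x \<le> e"
      using e K by (intro tail_dip_le) (auto simp: abs_less_iff less_imp_le)
    then have dip_x: "(tail_dip K x)\<^sup>2 \<le> e\<^sup>2"
      using tail_dip_nonneg by (intro power_mono)
    have "\<forall>\<^sub>F n in sequentially. \<forall>k\<in>{..<K}. 2 ^ (k + 2) * D n < e\<^sup>2"
      using e by (intro eventually_ball_finite) (auto intro!: D_small)
    moreover have "\<forall>\<^sub>F n in sequentially. 2 ^ (K + 3) * D n < 2 * e\<^sup>2"
      using e by (intro D_small) simp
    ultimately show "\<forall>\<^sub>F n in sequentially. dist (norm (X n)) 0 < e'"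
    proof eventually_elim
      case (elim n)
      have dip: "(tail_dip K (x + X n))\<^sup>2 + (tail_dip K (x - X n))\<^sup>2 \<le> (2 * e)\<^sup>2"
        using midpoint_defect_bounds(2)[of K x "X n", folded D_def] elim(2) dip_x by simp
      have dips: "tail_dip K (x + X n) \<le> 2 * e" "tail_dip K (x - X n) \<le> 2 * e"
        using e power2_le_imp_le[OF order_trans[OF _ dip], of "tail_dip K (x + X n)"]
          power2_le_imp_le[OF order_trans[OF _ dip], of "tail_dip K (x - X n)"]
        by simp_all
      have "\<bar>c0_nth (X n) j\<bar> \<le> 3 * e" for j
      proof (cases "j < K")
        case True
        then have "(c0_nth (X n) j)\<^sup>2 \<le> e\<^sup>2"
          using midpoint_defect_bounds(1)[of "X n" j x, folded D_def] elim(1) by force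
        then have "\<bar>c0_nth (X n) j\<bar> \<le> e"
          using e abs_le_square_iff[of "c0_nth (X n) j" e] by simp
        then show ?thesis
          using e by linarith
      next
        case False
        then have "- c0_nth (x + X n) j \<le> 2 * e" "- c0_nth (x - X n) j \<le> 2 * e" "\<bar>c0_nth x j\<bar> < e"
          using tail_dip_ge[of K j "x + X n"] tail_dip_ge[of K j "x - X n"] dips K by auto
        then show ?thesis
          by (simp add: plus_c0.rep_eq minus_c0.rep_eq)
      qed
      then have "norm (X n) \<le> 3 * e"
        by (rule norm_c0_le)
      then show ?case
        using e by (simp add: e_def)
    qed
  qed
qed


section \<open>Slices of the unit ball\<close>

text \<open>A far upward bump lowers the dips, and the weight of the coordinate where it sits is small.
  Since its height is \<open>norm x\<close>, it does not increase the sup norm by more than the small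
  number \<open>\<bar>c0_nth x n\<bar>\<close>.\<close>

lemma energy_bump_le:
  "energy (x + norm x *\<^sub>R unit_c0 n)
    \<le> energy x + (norm x + \<bar>c0_nth x n\<bar>)\<^sup>2 - (norm x)\<^sup>2 + (1 / 2) ^ (n + 2) * (2 * norm x)\<^sup>2"
proof -
  let ?y = "x + norm x *\<^sub>R unit_c0 n"
  let ?b = "\<lambda>k. if k = n then (1 / 2) ^ (n + 2) * (2 * norm x)\<^sup>2 else 0"
  have y: "c0_nth ?y j = c0_nth x j + (if j = n then norm x else 0)" for j
    by (simp add: plus_c0.rep_eq scaleR_c0.rep_eq unit_c0.rep_eq)
  have "norm ?y \<le> norm x + \<bar>c0_nth x n\<bar>"
  proof (rule norm_c0_le)
    show "\<bar>c0_nth ?y j\<bar> \<le> norm x + \<bar>c0_nth x n\<bar>" for j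
      using abs_c0_nth_le_norm[of x j] by (auto simp: y)
  qed
  then have norm_y: "(norm ?y)\<^sup>2 \<le> (norm x + \<bar>c0_nth x n\<bar>)\<^sup>2"
    by (intro power_mono) auto
  have term_y: "energy_term k ?y \<le> energy_term k x + ?b k" for k
  proof -
    have dip: "(tail_dip k ?y)\<^sup>2 \<le> (tail_dip k x)\<^sup>2"
      by (intro power_mono tail_dip_antimono tail_dip_nonneg) (simp add: y)
    show ?thesis
    proof (cases "k = n")
      case True
      have "\<bar>c0_nth ?y n\<bar> \<le> 2 * norm x"
        using abs_c0_nth_le_norm[of x n] by (simp add: y)
      then have "(c0_nth ?y n)\<^sup>2 \<le> (2 * norm x)\<^sup>2"
        using power_mono[of "\<bar>c0_nth ?y n\<bar>" "2 * norm x" 2] by simp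
      then have "(c0_nth ?y n)\<^sup>2 + (tail_dip n ?y)\<^sup>2
          \<le> ((c0_nth x n)\<^sup>2 + (tail_dip n x)\<^sup>2) + (2 * norm x)\<^sup>2"
        using dip[unfolded True] zero_le_power2[of "c0_nth x n"] by linarith
      then have "(1 / 2) ^ (n + 2) * ((c0_nth ?y n)\<^sup>2 + (tail_dip n ?y)\<^sup>2)
          \<le> (1 / 2) ^ (n + 2) * (((c0_nth x n)\<^sup>2 + (tail_dip n x)\<^sup>2) + (2 * norm x)\<^sup>2)"
        by (rule mult_left_mono) simp
      then show ?thesis
        using True by (simp add: energy_term_def distrib_left)
    next
      case False
      then show ?thesis
        using dip by (simp add: energy_term_def y)
    qed
  qed
  have b: "?b sums ((1 / 2) ^ (n + 2) * (2 * norm x)\<^sup>2)"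
    using sums_single[of n "\<lambda>_. (1 / 2) ^ (n + 2) * (2 * norm x)\<^sup>2"] .
  have "(\<Sum>k. energy_term k ?y) \<le> (\<Sum>k. energy_term k x + ?b k)"
    by (intro suminf_le term_y summable_energy_term summable_add sums_summable[OF b])
  also have "\<dots> = (\<Sum>k. energy_term k x) + (1 / 2) ^ (n + 2) * (2 * norm x)\<^sup>2"
    using suminf_add[OF summable_energy_term sums_summable[OF b], of x] sums_unique[OF b] by simp
  finally show ?thesis
    using norm_y unfolding energy_def by linarith
qed

lemma eventually_dip_norm_bump_less:
  assumes "dip_norm x < 1"
  shows "\<forall>\<^sub>F n in sequentially. dip_norm (x + norm x *\<^sub>R unit_c0 n) < 1"
proof -
  let ?r = "\<lambda>n. energy x + (norm x + \<bar>c0_nth x n\<bar>)\<^sup>2 - (norm x)\<^sup>2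
    + (1 / 2) ^ (n + 2) * (2 * norm x)\<^sup>2"
  have "(\<lambda>n. (1 / 2 :: real) ^ (n + 2)) \<longlonglongrightarrow> 0"
    by (intro LIMSEQ_ignore_initial_segment LIMSEQ_realpow_zero) auto
  then have "?r \<longlonglongrightarrow> energy x + (norm x + \<bar>0\<bar>)\<^sup>2 - (norm x)\<^sup>2 + 0 * (2 * norm x)\<^sup>2"
    by (intro tendsto_intros c0_nth_tendsto_zero)
  moreover have "energy x < 1"
    using assms by (simp add: dip_norm_def)
  ultimately have "\<forall>\<^sub>F n in sequentially. ?r n < 1"
    by (intro order_tendstoD(2)) auto
  then show ?thesis
    by eventually_elim (use energy_bump_le[of x] in \<open>auto simp: dip_norm_def intro: le_less_trans\<close>)
qed

text \<open>Where \<open>f\<close> is positive, scaling a point of the slice up to the sphere, and then slightly down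
  again, keeps it in the slice and leaves room in the ball for a far bump.\<close>

lemma norm_diameter_slice_ge:
  assumes f: "f \<noteq> 0" and "0 < \<delta>"
  shows "1 / sqrt 2 \<le> norm_diameter dip_norm (slice (unit_ball dip_norm) f \<delta>)"
proof (rule field_le_mult_one_interval)
  fix r :: real
  assume r: "0 < r" "r < 1"
  let ?B = "unit_ball dip_norm" and ?f = "blinfun_apply f"
  let ?S = "slice ?B f \<delta>"
  define s where "s = (SUP z\<in>?B. ?f z)"
  have mem_S: "z \<in> ?S \<longleftrightarrow> dip_norm z \<le> 1 \<and> s - \<delta> < ?f z" for z
    by (simp add: slice_def s_def unit_ball_def)
  have norm_B: "norm z \<le> 1" if "z \<in> ?B" for z
    using that norm_le_dip_norm[of z] by (simp add: unit_ball_def)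
  have bdd: "bdd_above (?f ` ?B)"
  proof (rule bdd_aboveI2)
    show "?f z \<le> norm f" if "z \<in> ?B" for z
      using norm_blinfun[of f z] mult_left_le[OF norm_B[OF that] norm_ge_zero[of f]] by simp
  qed
  have normalised: "inverse (dip_norm z) *\<^sub>R z \<in> ?B" for z
    by (cases "dip_norm z = 0") (simp_all add: unit_ball_def dip_norm_scaleR dip_norm_nonneg dip_norm_eq_0_iff
        dip_norm_eq_0_iff[THEN iffD2])
  have "0 < s"
  proof -
    obtain z where "?f z \<noteq> 0"
      using f by (metis blinfun_eqI zero_blinfun.rep_eq)
    then obtain z where z: "0 < ?f z"
      by (metis blinfun.minus_right neg_0_less_iff_less linorder_neqE_linordered_idom)
    then have "z \<noteq> 0"
      by auto
    then have "0 < dip_norm z"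
      using dip_norm_nonneg[of z] dip_norm_eq_0_iff[of z] by simp
    then have "0 < ?f (inverse (dip_norm z) *\<^sub>R z)"
      using z by (simp add: blinfun.scaleR_right)
    also have "\<dots> \<le> s"
      unfolding s_def by (intro cSUP_upper normalised bdd)
    finally show ?thesis .
  qed
  then have "max 0 (s - \<delta>) < s"
    using \<open>0 < \<delta>\<close> by simp
  moreover have "?B \<noteq> {}"
    using normalised by blast
  ultimately obtain w where w: "w \<in> ?B" "max 0 (s - \<delta>) < ?f w"
    unfolding s_def using bdd by (subst (asm) less_cSUP_iff) auto
  then have "w \<noteq> 0"
    by auto
  then have N_w: "0 < dip_norm w" "dip_norm w \<le> 1"
    using w dip_norm_nonneg[of w] dip_norm_eq_0_iff[of w] by (auto simp: unit_ball_def)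
  define y where "y = inverse (dip_norm w) *\<^sub>R w"
  have N_y: "dip_norm y = 1"
    using N_w by (simp add: y_def dip_norm_scaleR)
  have "?f w \<le> ?f y"
    using N_w w mult_right_mono[of 1 "inverse (dip_norm w)" "?f w"]
    by (simp add: y_def blinfun.scaleR_right one_le_inverse)
  then have f_y: "max 0 (s - \<delta>) < ?f y"
    using w by simp
  \<comment> \<open>The factor \<open>q\<close> must be close enough to one to stay in the slice, and at least \<open>r\<close> so that
    the bump is high enough.\<close>
  then have "max r (max 0 (s - \<delta>) / ?f y) < 1"
    using r by (simp add: divide_less_eq)
  then obtain q where q: "r < q" "max 0 (s - \<delta>) / ?f y < q" "q < 1"
    using dense by (metis max_less_iff_conj)
  define x where "x = q *\<^sub>R y"
  have N_x: "dip_norm x = q"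
    using q r N_y by (simp add: x_def dip_norm_scaleR)
  have f_x: "s - \<delta> < ?f x"
    using q f_y by (simp add: x_def blinfun.scaleR_right divide_less_eq)
  have norm_x: "r * (1 / sqrt 2) \<le> norm x"
    using dip_norm_le_norm[of x] q unfolding N_x by (simp add: field_simps)
  have "(\<lambda>n. ?f x + norm x * ?f (unit_c0 n)) \<longlonglongrightarrow> ?f x + norm x * 0"
    by (intro tendsto_intros blinfun_unit_c0_tendsto_zero)
  then have "\<forall>\<^sub>F n in sequentially. s - \<delta> < ?f x + norm x * ?f (unit_c0 n)"
    using f_x by (intro order_tendstoD(1)) auto
  then have "\<forall>\<^sub>F n in sequentially. x + norm x *\<^sub>R unit_c0 n \<in> ?S"
    using eventually_dip_norm_bump_less[of x, unfolded N_x, OF q(3)]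
    by eventually_elim (simp add: mem_S blinfun.add_right blinfun.scaleR_right)
  then obtain n where bump: "x + norm x *\<^sub>R unit_c0 n \<in> ?S"
    by (meson eventually_happens trivial_limit_sequentially)
  have x_S: "x \<in> ?S"
    using f_x N_x q(3) by (simp add: mem_S)
  have "norm x = c0_nth (norm x *\<^sub>R unit_c0 n) n"
    by (simp add: scaleR_c0.rep_eq unit_c0.rep_eq)
  also have "\<dots> \<le> norm (norm x *\<^sub>R unit_c0 n)"
    using abs_c0_nth_le_norm abs_le_D1 by blast
  also have "\<dots> \<le> dip_norm ((x + norm x *\<^sub>R unit_c0 n) - x)"
    using norm_le_dip_norm[of "norm x *\<^sub>R unit_c0 n"] by simp
  also have "\<dots> \<le> norm_diameter dip_norm ?S"
  proof -
    have "bdd_above ((\<lambda>(u, v). dip_norm (u - v)) ` (?S \<times> ?S))"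
    proof (rule bdd_aboveI2, clarify)
      fix u v
      assume "u \<in> ?S" "v \<in> ?S"
      then have "norm (u - v) \<le> 2"
        using norm_B[of u] norm_B[of v] norm_triangle_ineq4[of u v] by (simp add: slice_def)
      then show "dip_norm (u - v) \<le> sqrt 2 * 2"
        using order_trans[OF dip_norm_le_norm[of "u - v"]] by (simp add: mult_left_mono)
    qed
    then show ?thesis
      unfolding norm_diameter_def
      using cSUP_upper[of "(x + norm x *\<^sub>R unit_c0 n, x)" "?S \<times> ?S" "\<lambda>(u, v). dip_norm (u - v)"]
        bump x_S by simp
  qed
  finally show "r * (1 / sqrt 2) \<le> norm_diameter dip_norm ?S"
    using norm_x by simp
qed

theorem proposition3p1:
  shows "\<exists>N :: c0 \<Rightarrow> real.
    nonsymmetric_norm N \<and> equivalent_norm N \<and> MLUR N \<and>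
    \<not> (\<exists>x. denting_point N (unit_ball N) x) \<and>
    (\<forall>S. is_slice (unit_ball N) S \<longrightarrow> norm_diameter N S \<ge> 1 / sqrt 2)"
proof (intro exI conjI)
  show "nonsymmetric_norm dip_norm" "equivalent_norm dip_norm" "MLUR dip_norm"
    by (fact nonsymmetric_norm_dip_norm equivalent_norm_dip_norm MLUR_dip_norm)+
  show "\<forall>S. is_slice (unit_ball dip_norm) S \<longrightarrow> norm_diameter dip_norm S \<ge> 1 / sqrt 2"
    unfolding is_slice_def using norm_diameter_slice_ge by blast
  show "\<not> (\<exists>x. denting_point dip_norm (unit_ball dip_norm) x)"
  proof
    assume "\<exists>x. denting_point dip_norm (unit_ball dip_norm) x"
    then obtain x where "denting_point dip_norm (unit_ball dip_norm) x" ..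
    moreover have "0 < 1 / sqrt (2 :: real)" "0 < (1 :: real)"
      by simp_all
    ultimately obtain f where "f \<noteq> 0"
      "norm_diameter dip_norm (slice (unit_ball dip_norm) f 1) < 1 / sqrt 2"
      unfolding denting_point_def by blast
    then show False
      using norm_diameter_slice_ge[of f 1] by simp
  qed
qed

end
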